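(* Let $R$ be a unital ring and $M$ a unitary right $R$-module. Every complemented distributive submodule $N\subseteq M$ is stable under every $f\in\operatorname{End}_R(M)$, i.e., $f(N)\subseteq N$ for every $f\in\operatorname{End}_R(M)$.
   Context: A submodule $N\subseteq M$ is distributive if $(Y_1+Y_2)\cap N=(Y_1\cap N)+(Y_2\cap N)$ for all submodules $Y_1,Y_2\subseteq M$. A complemented distributive submodule of $M$ is a distributive submodule that is also a direct summand of $M$. *)

theory Defs
  imports "HOL-Algebra.Algebra"
begin

text \<open>
  HOL-Algebra's locale \<open>module\<close> covers commutative rings only. A right module over a
  possibly noncommutative ring is represented by the same record type, with
  \<open>a \<odot>\<^bsub>M\<^esub> x\<close> standing for the right action \<open>x \<cdot> a\<close>; hence the order of the
  factors in \<open>rsmult_assoc\<close>. The multiplication and unit fields of \<open>M\<close> are not used.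
  The library predicate \<open>submodule\<close> does not presuppose commutativity of \<open>R\<close> and
  applies to this encoding unchanged.
\<close>

locale right_module = R?: ring R + M?: abelian_group M
  for R :: "('a, 'r) ring_scheme" (structure) and M :: "('a, 'b, 'm) module_scheme" (structure) +
  assumes rsmult_closed [simp, intro]:
      "\<lbrakk>a \<in> carrier R; x \<in> carrier M\<rbrakk> \<Longrightarrow> a \<odot>\<^bsub>M\<^esub> x \<in> carrier M"
    and rsmult_ring_distr:
      "\<lbrakk>a \<in> carrier R; b \<in> carrier R; x \<in> carrier M\<rbrakk> \<Longrightarrow>
        (a \<oplus>\<^bsub>R\<^esub> b) \<odot>\<^bsub>M\<^esub> x = a \<odot>\<^bsub>M\<^esub> x \<oplus>\<^bsub>M\<^esub> b \<odot>\<^bsub>M\<^esub> x"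
    and rsmult_module_distr:
      "\<lbrakk>a \<in> carrier R; x \<in> carrier M; y \<in> carrier M\<rbrakk> \<Longrightarrow>
        a \<odot>\<^bsub>M\<^esub> (x \<oplus>\<^bsub>M\<^esub> y) = a \<odot>\<^bsub>M\<^esub> x \<oplus>\<^bsub>M\<^esub> a \<odot>\<^bsub>M\<^esub> y"
    and rsmult_assoc:
      "\<lbrakk>a \<in> carrier R; b \<in> carrier R; x \<in> carrier M\<rbrakk> \<Longrightarrow>
        (a \<otimes>\<^bsub>R\<^esub> b) \<odot>\<^bsub>M\<^esub> x = b \<odot>\<^bsub>M\<^esub> (a \<odot>\<^bsub>M\<^esub> x)"
    and rsmult_one [simp]:
      "x \<in> carrier M \<Longrightarrow> \<one>\<^bsub>R\<^esub> \<odot>\<^bsub>M\<^esub> x = x"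

definition module_End ::
    "('a, 'r) ring_scheme \<Rightarrow> ('a, 'b, 'm) module_scheme \<Rightarrow> ('b \<Rightarrow> 'b) set" where
  "module_End R M =
    {f \<in> hom (add_monoid M) (add_monoid M).
      \<forall>a \<in> carrier R. \<forall>x \<in> carrier M. f (a \<odot>\<^bsub>M\<^esub> x) = a \<odot>\<^bsub>M\<^esub> f x}"

definition distributive_submodule ::
    "('a, 'r) ring_scheme \<Rightarrow> ('a, 'b, 'm) module_scheme \<Rightarrow> 'b set \<Rightarrow> bool" where
  "distributive_submodule R M N \<longleftrightarrow>
    submodule N R M \<and>
    (\<forall>Y\<^sub>1 Y\<^sub>2. submodule Y\<^sub>1 R M \<longrightarrow> submodule Y\<^sub>2 R M \<longrightarrow>
      (Y\<^sub>1 <+>\<^bsub>M\<^esub> Y\<^sub>2) \<inter> N = (Y\<^sub>1 \<inter> N) <+>\<^bsub>M\<^esub> (Y\<^sub>2 \<inter> N))"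

definition direct_summand ::
    "('a, 'r) ring_scheme \<Rightarrow> ('a, 'b, 'm) module_scheme \<Rightarrow> 'b set \<Rightarrow> bool" where
  "direct_summand R M N \<longleftrightarrow>
    submodule N R M \<and>
    (\<exists>C. submodule C R M \<and> N <+>\<^bsub>M\<^esub> C = carrier M \<and> N \<inter> C = {\<zero>\<^bsub>M\<^esub>})"

definition complemented_distributive_submodule ::
    "('a, 'r) ring_scheme \<Rightarrow> ('a, 'b, 'm) module_scheme \<Rightarrow> 'b set \<Rightarrow> bool" where
  "complemented_distributive_submodule R M N \<longleftrightarrow>
    distributive_submodule R M N \<and> direct_summand R M N"

end

theory Submission
  imports Defs
begin

text \<open>
  Let \<open>M = N \<oplus> C\<close> with \<open>N\<close> distributive, and let \<open>f\<close> be an endomorphism of \<open>M\<close>. The composite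
  of \<open>f\<close> with the projection along \<open>N\<close> onto \<open>C\<close> restricts to a homomorphism \<open>g\<close> from \<open>N\<close> to
  \<open>C\<close>, and \<open>f(N) \<subseteq> N\<close> means exactly that \<open>g = 0\<close>.

  The graph \<open>Y = {n + g(n) | n \<in> N}\<close> is a submodule, and \<open>Y + C\<close> contains \<open>N\<close> because
  \<open>n = (n + g(n)) - g(n)\<close>. Distributivity of \<open>N\<close> therefore gives
  \<open>N = (Y + C) \<inter> N = (Y \<inter> N) + (C \<inter> N) = Y \<inter> N\<close>, that is, \<open>N \<subseteq> Y\<close>. But an element \<open>n + g(n)\<close>
  of the graph can lie in \<open>N\<close> only if its component \<open>g(n)\<close> in \<open>C\<close> vanishes, so every \<open>n \<in> N\<close>
  has \<open>g(n) = 0\<close>.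
\<close>

context right_module
begin

lemma submoduleI:
  assumes "H \<subseteq> carrier M"
    and "\<zero>\<^bsub>M\<^esub> \<in> H"
    and "\<And>x. x \<in> H \<Longrightarrow> \<ominus>\<^bsub>M\<^esub> x \<in> H"
    and "\<And>x y. \<lbrakk>x \<in> H; y \<in> H\<rbrakk> \<Longrightarrow> x \<oplus>\<^bsub>M\<^esub> y \<in> H"
    and "\<And>a x. \<lbrakk>a \<in> carrier R; x \<in> H\<rbrakk> \<Longrightarrow> a \<odot>\<^bsub>M\<^esub> x \<in> H"
  shows "submodule H R M"
  by (intro submodule.intro subgroup.intro)
    (use assms in \<open>simp_all add: submodule_axioms_def a_inv_def\<close>)

lemma submoduleD:
  assumes "submodule H R M"
  shows "H \<subseteq> carrier M"
    and "\<zero>\<^bsub>M\<^esub> \<in> H"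
    and "\<And>x. x \<in> H \<Longrightarrow> \<ominus>\<^bsub>M\<^esub> x \<in> H"
    and "\<And>x y. \<lbrakk>x \<in> H; y \<in> H\<rbrakk> \<Longrightarrow> x \<oplus>\<^bsub>M\<^esub> y \<in> H"
    and "\<And>a x. \<lbrakk>a \<in> carrier R; x \<in> H\<rbrakk> \<Longrightarrow> a \<odot>\<^bsub>M\<^esub> x \<in> H"
proof -
  have sub: "subgroup H (add_monoid M)"
    using assms by (rule submodule.axioms)
  show "H \<subseteq> carrier M" "\<zero>\<^bsub>M\<^esub> \<in> H"
    using subgroup.subset[OF sub] subgroup.one_closed[OF sub] by simp_all
  show "\<ominus>\<^bsub>M\<^esub> x \<in> H" if "x \<in> H" for x
    using subgroup.m_inv_closed[OF sub that] by (simp add: a_inv_def)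
  show "x \<oplus>\<^bsub>M\<^esub> y \<in> H" if "x \<in> H" "y \<in> H" for x y
    using subgroup.m_closed[OF sub that] by simp
  show "a \<odot>\<^bsub>M\<^esub> x \<in> H" if "a \<in> carrier R" "x \<in> H" for a x
    using submodule.smult_closed[OF assms that] .
qed

lemma module_EndD:
  assumes "f \<in> module_End R M"
  shows "\<And>x. x \<in> carrier M \<Longrightarrow> f x \<in> carrier M"
    and "\<And>x y. \<lbrakk>x \<in> carrier M; y \<in> carrier M\<rbrakk> \<Longrightarrow> f (x \<oplus>\<^bsub>M\<^esub> y) = f x \<oplus>\<^bsub>M\<^esub> f y"
    and "\<And>a x. \<lbrakk>a \<in> carrier R; x \<in> carrier M\<rbrakk> \<Longrightarrow> f (a \<odot>\<^bsub>M\<^esub> x) = a \<odot>\<^bsub>M\<^esub> f x"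
    and "f \<zero>\<^bsub>M\<^esub> = \<zero>\<^bsub>M\<^esub>"
    and "\<And>x. x \<in> carrier M \<Longrightarrow> f (\<ominus>\<^bsub>M\<^esub> x) = \<ominus>\<^bsub>M\<^esub> f x"
proof -
  have hom: "f \<in> hom (add_monoid M) (add_monoid M)"
    using assms by (simp add: module_End_def)
  then interpret f: group_hom "add_monoid M" "add_monoid M" f
    by (intro group_hom.intro group_hom_axioms.intro M.a_group)
  show "f x \<in> carrier M" if "x \<in> carrier M" for x
    using f.hom_closed that by simp
  show "f (x \<oplus>\<^bsub>M\<^esub> y) = f x \<oplus>\<^bsub>M\<^esub> f y" if "x \<in> carrier M" "y \<in> carrier M" for x y
    using f.hom_mult that by simp
  show "f (a \<odot>\<^bsub>M\<^esub> x) = a \<odot>\<^bsub>M\<^esub> f x" if "a \<in> carrier R" "x \<in> carrier M" for a x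
    using assms that by (simp add: module_End_def)
  show "f \<zero>\<^bsub>M\<^esub> = \<zero>\<^bsub>M\<^esub>"
    using f.hom_one by simp
  show "f (\<ominus>\<^bsub>M\<^esub> x) = \<ominus>\<^bsub>M\<^esub> f x" if "x \<in> carrier M" for x
    using f.hom_inv that by (simp add: a_inv_def)
qed

text \<open>
  If \<open>N\<close> and \<open>C\<close> are complementary, then \<open>f n = k + c\<close> with \<open>k \<in> N\<close> and \<open>c \<in> C\<close> says that \<open>c\<close> is
  the \<open>C\<close>-component of \<open>f n\<close>, so that this set is the graph of the \<open>C\<close>-component of \<open>f\<close> on \<open>N\<close>.
  Describing it by the equation instead of a projection map avoids constructing the projection.
\<close>

definition component_graph :: "('b \<Rightarrow> 'b) \<Rightarrow> 'b set \<Rightarrow> 'b set \<Rightarrow> 'b set" where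
  "component_graph f N C =
    {n \<oplus>\<^bsub>M\<^esub> c | n c. n \<in> N \<and> c \<in> C \<and> (\<exists>k \<in> N. f n = k \<oplus>\<^bsub>M\<^esub> c)}"

lemma component_graphI:
  assumes "n \<in> N" "c \<in> C" "k \<in> N" "f n = k \<oplus>\<^bsub>M\<^esub> c"
  shows "n \<oplus>\<^bsub>M\<^esub> c \<in> component_graph f N C"
  using assms unfolding component_graph_def by blast

lemma component_graphE:
  assumes "y \<in> component_graph f N C"
  obtains n c k where "y = n \<oplus>\<^bsub>M\<^esub> c" "n \<in> N" "c \<in> C" "k \<in> N" "f n = k \<oplus>\<^bsub>M\<^esub> c"
  using assms unfolding component_graph_def by blast

lemma submodule_component_graph:
  assumes f: "f \<in> module_End R M" and N: "submodule N R M" and C: "submodule C R M"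
  shows "submodule (component_graph f N C) R M"
proof (rule submoduleI)
  note Ncl = submoduleD[OF N] and Ccl = submoduleD[OF C] and fD = module_EndD[OF f]
  have inM: "x \<in> carrier M" if "x \<in> N \<or> x \<in> C" for x
    using that Ncl(1) Ccl(1) by blast
  show "component_graph f N C \<subseteq> carrier M"
    by (auto elim!: component_graphE simp: inM)
  show "\<zero>\<^bsub>M\<^esub> \<in> component_graph f N C"
    using component_graphI[of "\<zero>\<^bsub>M\<^esub>" N "\<zero>\<^bsub>M\<^esub>" C "\<zero>\<^bsub>M\<^esub>" f] Ncl(2) Ccl(2) fD(4) by simp
  show "\<ominus>\<^bsub>M\<^esub> y \<in> component_graph f N C" if y: "y \<in> component_graph f N C" for y
    using y
  proof (rule component_graphE)
    fix n c k
    assume *: "y = n \<oplus>\<^bsub>M\<^esub> c" "n \<in> N" "c \<in> C" "k \<in> N" "f n = k \<oplus>\<^bsub>M\<^esub> c"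
    have "(\<ominus>\<^bsub>M\<^esub> n) \<oplus>\<^bsub>M\<^esub> (\<ominus>\<^bsub>M\<^esub> c) \<in> component_graph f N C"
      by (rule component_graphI[of _ _ _ _ "\<ominus>\<^bsub>M\<^esub> k"])
        (use * in \<open>simp_all add: Ncl(3) Ccl(3) fD(5) inM M.minus_add\<close>)
    then show ?thesis
      using * by (simp add: inM M.minus_add)
  qed
  show "y \<oplus>\<^bsub>M\<^esub> y' \<in> component_graph f N C"
    if y: "y \<in> component_graph f N C" and y': "y' \<in> component_graph f N C" for y y'
  proof -
    obtain n c k where *: "y = n \<oplus>\<^bsub>M\<^esub> c" "n \<in> N" "c \<in> C" "k \<in> N" "f n = k \<oplus>\<^bsub>M\<^esub> c"
      using y by (rule component_graphE)
    obtain n' c' k' where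
      **: "y' = n' \<oplus>\<^bsub>M\<^esub> c'" "n' \<in> N" "c' \<in> C" "k' \<in> N" "f n' = k' \<oplus>\<^bsub>M\<^esub> c'"
      using y' by (rule component_graphE)
    have "(n \<oplus>\<^bsub>M\<^esub> n') \<oplus>\<^bsub>M\<^esub> (c \<oplus>\<^bsub>M\<^esub> c') \<in> component_graph f N C"
      by (rule component_graphI[of _ _ _ _ "k \<oplus>\<^bsub>M\<^esub> k'"])
        (use * ** in \<open>simp_all add: Ncl(4) Ccl(4) fD(2) inM M.a_ac\<close>)
    then show ?thesis
      using * ** by (simp add: inM M.a_ac)
  qed
  show "a \<odot>\<^bsub>M\<^esub> y \<in> component_graph f N C"
    if a: "a \<in> carrier R" and y: "y \<in> component_graph f N C" for a y
    using y
  proof (rule component_graphE)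
    fix n c k
    assume *: "y = n \<oplus>\<^bsub>M\<^esub> c" "n \<in> N" "c \<in> C" "k \<in> N" "f n = k \<oplus>\<^bsub>M\<^esub> c"
    have "a \<odot>\<^bsub>M\<^esub> n \<oplus>\<^bsub>M\<^esub> a \<odot>\<^bsub>M\<^esub> c \<in> component_graph f N C"
      by (rule component_graphI[of _ _ _ _ "a \<odot>\<^bsub>M\<^esub> k"])
        (use a * in \<open>simp_all add: Ncl(5) Ccl(5) fD(3) inM rsmult_module_distr\<close>)
    then show ?thesis
      using a * by (simp add: inM rsmult_module_distr)
  qed
qed

text \<open>
  Independence of \<open>N\<close> and \<open>C\<close> leaves no room for a point of the graph inside \<open>N\<close> whose
  \<open>C\<close>-component is nonzero: that component is a difference of two elements of \<open>N\<close>.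
\<close>

lemma component_graph_Int_stable:
  assumes N: "submodule N R M" and C: "submodule C R M"
    and indep: "N \<inter> C = {\<zero>\<^bsub>M\<^esub>}"
    and x: "x \<in> component_graph f N C" "x \<in> N"
  shows "f x \<in> N"
proof -
  note Ncl = submoduleD[OF N] and Ccl = submoduleD[OF C]
  obtain n c k where *: "x = n \<oplus>\<^bsub>M\<^esub> c" "n \<in> N" "c \<in> C" "k \<in> N" "f n = k \<oplus>\<^bsub>M\<^esub> c"
    using x(1) by (rule component_graphE)
  then have carr: "n \<in> carrier M" "c \<in> carrier M" "k \<in> carrier M"
    using Ncl(1) Ccl(1) by auto
  have "c = (\<ominus>\<^bsub>M\<^esub> n) \<oplus>\<^bsub>M\<^esub> x"
    using * carr by (simp add: M.r_neg1)
  then have "c \<in> N"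
    using *(2) x(2) Ncl(3,4) by simp
  then have "c = \<zero>\<^bsub>M\<^esub>"
    using *(3) indep by blast
  then show ?thesis
    using * carr by simp
qed

text \<open>
  The graph and \<open>C\<close> together generate every \<open>n \<in> N\<close>, as \<open>n = (n + c) - c\<close> with \<open>c\<close> the
  \<open>C\<close>-component of \<open>f n\<close>. Distributivity replaces these two summands by elements of \<open>N\<close>, and
  then the one from \<open>C\<close> is zero.
\<close>

lemma distributive_subset_component_graph:
  assumes f: "f \<in> module_End R M"
    and dist: "distributive_submodule R M N"
    and C: "submodule C R M"
    and span: "N <+>\<^bsub>M\<^esub> C = carrier M" and indep: "N \<inter> C = {\<zero>\<^bsub>M\<^esub>}"
  shows "N \<subseteq> component_graph f N C"
proof
  let ?Y = "component_graph f N C"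
  have N: "submodule N R M"
    using dist by (simp add: distributive_submodule_def)
  note Ncl = submoduleD[OF N] and Ccl = submoduleD[OF C]
  have Y: "submodule ?Y R M"
    using f N C by (rule submodule_component_graph)
  fix n
  assume n: "n \<in> N"
  then have nM: "n \<in> carrier M"
    using Ncl(1) by auto
  then have "f n \<in> N <+>\<^bsub>M\<^esub> C"
    using module_EndD(1)[OF f] span by simp
  then obtain k c where kc: "k \<in> N" "c \<in> C" "f n = k \<oplus>\<^bsub>M\<^esub> c"
    by (auto simp: set_add_def')
  then have cM: "c \<in> carrier M"
    using Ccl(1) by auto
  have "n \<oplus>\<^bsub>M\<^esub> c \<in> ?Y" "\<ominus>\<^bsub>M\<^esub> c \<in> C"
    using component_graphI[of n N c C k f] n kc Ccl(3) by auto
  moreover have "n = (n \<oplus>\<^bsub>M\<^esub> c) \<oplus>\<^bsub>M\<^esub> (\<ominus>\<^bsub>M\<^esub> c)"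
    using nM cM by (simp add: M.a_assoc M.r_neg)
  ultimately have "n \<in> (?Y <+>\<^bsub>M\<^esub> C) \<inter> N"
    using n by (auto simp: set_add_def')
  also have "\<dots> = (?Y \<inter> N) <+>\<^bsub>M\<^esub> (C \<inter> N)"
    using dist Y C by (simp add: distributive_submodule_def)
  also have "C \<inter> N = {\<zero>\<^bsub>M\<^esub>}"
    using indep by blast
  finally obtain y where "y \<in> ?Y" "n = y \<oplus>\<^bsub>M\<^esub> \<zero>\<^bsub>M\<^esub>"
    by (auto simp: set_add_def')
  then show "n \<in> ?Y"
    using submoduleD(1)[OF Y] by auto
qed

end

theorem lemma3p14:
  fixes R :: "('a, 'r) ring_scheme"
    and M :: "('a, 'b, 'm) module_scheme"
    and N :: "'b set"
  assumes "right_module R M"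
    and "complemented_distributive_submodule R M N"
  shows "\<forall>f \<in> module_End R M. f ` N \<subseteq> N"
proof -
  interpret right_module R M
    by fact
  have dist: "distributive_submodule R M N" and N: "submodule N R M"
    using assms(2)
    by (simp_all add: complemented_distributive_submodule_def distributive_submodule_def)
  obtain C where C: "submodule C R M" "N <+>\<^bsub>M\<^esub> C = carrier M" "N \<inter> C = {\<zero>\<^bsub>M\<^esub>}"
    using assms(2) by (auto simp: complemented_distributive_submodule_def direct_summand_def)
  show ?thesis
    using distributive_subset_component_graph[OF _ dist C]
      component_graph_Int_stable[OF N C(1,3)] by blast
qed

end
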